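(* Let $p$ be a prime, let $d, w_1, w_2 \in \mathbb{N}$, let $\chi$ be a Dirichlet character with conductor $d$ (with values in $\mathbb{C}_p$), and let $\xi \in T_p$. For all $n \in \mathbb{Z}_+$, $m \in \mathbb{N}$ and all $x, y\in\mathbb{C}_p$, $$\sum_{j=0}^{n}\binom{n}{j}w_2^{j} w_1^{n-j-1}B_{n-j,\chi,\xi^{w_1}}^{(m)}(w_2x)\sum_{k=0}^{j}\binom{j}{k}T_{k,\chi,\xi^{w_2}}(w_1d-1)\,B_{j-k,\chi,\xi^{w_2}}^{(m-1)}(w_1y)$$ $$=\sum_{j=0}^{n}\binom{n}{j}w_1^{j} w_2^{n-j-1}B_{n-j,\chi,\xi^{w_2}}^{(m)}(w_1x)\sum_{k=0}^{j}\binom{j}{k}T_{k,\chi,\xi^{w_1}}(w_2d-1)\,B_{j-k,\chi,\xi^{w_1}}^{(m-1)}(w_2y).$$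
   Context: $\mathbb{N}=\{1,2,3,\dots\}$ and $\mathbb{Z}_+=\mathbb{N}\cup\{0\}$. $\mathbb{C}_p$ is the completion of an algebraic closure of $\mathbb{Q}_p$. $T_p=\bigcup_{n\ge 1}\{\omega\in\mathbb{C}_p : \omega^{p^n}=1\}$ is the group of $p$-power roots of unity. For $\xi\in T_p$, a Dirichlet character $\chi$ with conductor $d$, and an integer $k\ge 0$, the generalized twisted Bernoulli polynomials of order $k$ attached to $\chi$, $B_{n,\chi,\xi}^{(k)}(x)$, are defined by the identity of formal power series in $t$ $$\left(\frac{t\sum_{a=0}^{d-1}\chi(a)\xi^a e^{at}}{\xi^d e^{dt}-1}\right)^k e^{xt}=\sum_{n=0}^{\infty}B_{n,\chi,\xi}^{(k)}(x)\frac{t^n}{n!}$$ (so for $k=0$ one has $B_{n,\chi,\xi}^{(0)}(x)=x^n$, with $0^0=1$). For $k,n\in\mathbb{Z}_+$, the power sums are $T_{k,\chi,\xi}(n)=\sum_{l=0}^{n}\chi(l)\xi^l l^k$, with $0^0=1$. *)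

theory Defs
  imports "HOL-Analysis.Abstract_Metric_Spaces" "HOL-Number_Theory.Cong"
    "HOL-Computational_Algebra.Computational_Algebra"
begin

definition nonarch_abs :: "('a::field \<Rightarrow> real) \<Rightarrow> bool" where
  "nonarch_abs v \<longleftrightarrow>
     (\<forall>x. 0 \<le> v x) \<and>
     (\<forall>x. v x = 0 \<longleftrightarrow> x = 0) \<and>
     (\<forall>x y. v (x * y) = v x * v y) \<and>
     (\<forall>x y. v (x + y) \<le> max (v x) (v y))"

definition abs_closure :: "('a::field \<Rightarrow> real) \<Rightarrow> 'a set \<Rightarrow> 'a set" where
  "abs_closure v S = Metric_space.mtopology UNIV (\<lambda>x y. v (x - y)) closure_of S"

definition algebraic_over :: "'a::field set \<Rightarrow> 'a set" where
  "algebraic_over F = {x. \<exists>f. f \<noteq> 0 \<and> (\<forall>i. coeff f i \<in> F) \<and> poly f x = 0}"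

definition algebraically_closed_subset :: "'a::field set \<Rightarrow> bool" where
  "algebraically_closed_subset A \<longleftrightarrow>
     (\<forall>f. degree f > 0 \<and> (\<forall>i. coeff f i \<in> A) \<longrightarrow> (\<exists>x\<in>A. poly f x = 0))"

(* The pair consisting of the type 'a and the absolute value v is a completion of an algebraic
   closure of the p-adic numbers.  In a complete field, the closure Q of the rationals is their
   completion, so Q is the field of p-adic numbers once v is the p-adic absolute value on the
   integers.  The set A is then required to be an algebraic closure of Q and to be dense.
   All such pairs are isometrically isomorphic. *)
definition p_adic_complex_field :: "nat \<Rightarrow> ('a::field_char_0 \<Rightarrow> real) \<Rightarrow> bool" where
  "p_adic_complex_field p v \<longleftrightarrow>
     nonarch_abs v \<and>
     (\<forall>z::int. z \<noteq> 0 \<longrightarrow> v (of_int z) = inverse (real p) ^ multiplicity (int p) z) \<and>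
     Metric_space.mcomplete UNIV (\<lambda>x y. v (x - y)) \<and>
     (let Q = abs_closure v \<rat>; A = algebraic_over Q
      in algebraically_closed_subset A \<and> abs_closure v A = UNIV)"

definition p_power_roots_of_unity :: "nat \<Rightarrow> 'a::field set" where
  "p_power_roots_of_unity p = (\<Union>n\<in>{1..}. {\<omega>. \<omega> ^ (p ^ n) = 1})"

(* Characters modulo N, extended by zero to all natural numbers. *)
definition dirichlet_character :: "nat \<Rightarrow> (nat \<Rightarrow> 'a::field) \<Rightarrow> bool" where
  "dirichlet_character N chi \<longleftrightarrow>
     N > 0 \<and>
     (\<forall>a. chi (a + N) = chi a) \<and>
     (\<forall>a b. chi (a * b) = chi a * chi b) \<and>
     (\<forall>a. chi a \<noteq> 0 \<longleftrightarrow> coprime a N)"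

definition induced_modulus :: "nat \<Rightarrow> (nat \<Rightarrow> 'a::field) \<Rightarrow> nat \<Rightarrow> bool" where
  "induced_modulus N chi f \<longleftrightarrow>
     f dvd N \<and> (\<forall>a. coprime a N \<and> [a = 1] (mod f) \<longrightarrow> chi a = 1)"

definition conductor :: "nat \<Rightarrow> (nat \<Rightarrow> 'a::field) \<Rightarrow> nat" where
  "conductor N chi = (LEAST f. f > 0 \<and> induced_modulus N chi f)"

definition bernoulli_numer :: "nat \<Rightarrow> (nat \<Rightarrow> 'a::field_char_0) \<Rightarrow> 'a \<Rightarrow> 'a fps" where
  "bernoulli_numer d chi \<xi> =
     fps_X * (\<Sum>a = 0..d - 1. fps_const (chi a * \<xi> ^ a) * fps_exp (of_nat a))"

definition bernoulli_denom :: "nat \<Rightarrow> 'a::field_char_0 \<Rightarrow> 'a fps" where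
  "bernoulli_denom d \<xi> = fps_const (\<xi> ^ d) * fps_exp (of_nat d) - 1"

(* The denominator is not invertible when \<xi> ^ d = 1, but it always divides the numerator
   (bernoulli_denom_dvd_numer below), so the division of power series is exact. *)
definition gen_twisted_bernoulli ::
  "nat \<Rightarrow> nat \<Rightarrow> nat \<Rightarrow> (nat \<Rightarrow> 'a::field_char_0) \<Rightarrow> 'a \<Rightarrow> 'a \<Rightarrow> 'a" where
  "gen_twisted_bernoulli d k n chi \<xi> x =
     fact n * fps_nth ((bernoulli_numer d chi \<xi> / bernoulli_denom d \<xi>) ^ k * fps_exp x) n"

definition twisted_power_sum :: "nat \<Rightarrow> (nat \<Rightarrow> 'a::field_char_0) \<Rightarrow> 'a \<Rightarrow> nat \<Rightarrow> 'a" where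
  "twisted_power_sum k chi \<xi> n = (\<Sum>l = 0..n. chi l * \<xi> ^ l * of_nat l ^ k)"

lemma bernoulli_denom_nonzero:
  assumes "d > 0" "\<xi> \<noteq> 0"
  shows "bernoulli_denom d \<xi> \<noteq> 0" "subdegree (bernoulli_denom d \<xi>) \<le> 1"
proof -
  have "fps_nth (bernoulli_denom d \<xi>) 1 \<noteq> 0"
    using assms by (simp add: bernoulli_denom_def)
  then show "bernoulli_denom d \<xi> \<noteq> 0" "subdegree (bernoulli_denom d \<xi>) \<le> 1"
    by (auto intro: subdegree_leI)
qed

lemma bernoulli_denom_dvd_numer:
  assumes "d > 0" "\<xi> \<noteq> 0"
  shows "bernoulli_denom d \<xi> dvd bernoulli_numer d chi \<xi>"
proof (cases "bernoulli_numer d chi \<xi> = 0")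
  case False
  have "fps_nth (bernoulli_numer d chi \<xi>) 0 = 0"
    by (simp add: bernoulli_numer_def)
  with False have "subdegree (bernoulli_numer d chi \<xi>) \<ge> 1"
    by (intro subdegree_geI) auto
  with False bernoulli_denom_nonzero[OF assms] show ?thesis
    by (simp add: fps_dvd_iff)
qed simp

lemma gen_twisted_bernoulli_egf:
  "Abs_fps (\<lambda>n. gen_twisted_bernoulli d k n chi \<xi> x / fact n) =
     (bernoulli_numer d chi \<xi> / bernoulli_denom d \<xi>) ^ k * fps_exp x"
  by (simp add: fps_eq_iff gen_twisted_bernoulli_def)

lemma gen_twisted_bernoulli_order_0: "gen_twisted_bernoulli d 0 n chi \<xi> x = x ^ n"
  by (simp add: gen_twisted_bernoulli_def)

end

theory Submission
  imports Defs
begin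

text \<open>
  The idea is to encode both sides by exponential generating functions.  Let
  \<open>A\<^sub>\<zeta>(t) = (\<Sum>a<d. \<chi>(a) \<zeta>\<^sup>a e\<^bsup>at\<^esup>)\<close> and
  \<open>F\<^sub>\<zeta>(t) = t A\<^sub>\<zeta>(t) / (\<zeta>\<^sup>d e\<^bsup>dt\<^esup> - 1)\<close>, so that \<open>F\<^sub>\<zeta>(t)\<^sup>k e\<^bsup>zt\<^esup>\<close> generates the
  Bernoulli polynomials of order \<open>k\<close> at \<open>z\<close>.
  The power sums \<open>T\<^sub>k(wd - 1)\<close> are generated by the
  finite sum \<open>S(t) = (\<Sum>l<wd. \<chi>(l) \<zeta>\<^sup>l e\<^bsup>lt\<^esup>)\<close>.  As \<open>\<chi>\<close> is \<open>d\<close>-periodic, each block of \<open>d\<close>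
  consecutive terms is \<open>\<zeta>\<^sup>d e\<^bsup>dt\<^esup>\<close> times the preceding one; summing the geometric series gives
  \<open>t S(t) = F\<^sub>\<zeta>(t) (\<zeta>\<^bsup>wd\<^esup> e\<^bsup>wdt\<^esup> - 1)\<close>
  (lemma \<open>fps_X_times_twisted_exp_sum\<close>).

  The nested binomial sums are coefficients of products of rescaled series
  (lemma \<open>scaled_binomial_convolution\<close>).
  For the left-hand side the product is \<open>1/w\<^sub>1\<close> times
  \<open>F\<^sub>1(w\<^sub>1 t)\<^sup>m e\<^bsup>w1 w2 x t\<^esup> S\<^sub>2(w\<^sub>2 t) F\<^sub>2(w\<^sub>2 t)\<^bsup>m-1\<^esup> e\<^bsup>w1 w2 y t\<^esup>\<close>, where \<open>F\<^sub>i\<close>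
  and \<open>S\<^sub>i\<close> are \<open>F\<^sub>\<zeta>\<close> and \<open>S\<close> for \<open>\<zeta> = \<xi>\<^bsup>wi\<^esup>\<close>, with \<open>w = w\<^sub>1\<close> in \<open>S\<close>.  Multiplying by \<open>w\<^sub>1 w\<^sub>2 t\<close> and using
  the formula for \<open>S\<^sub>2\<close> turns the product into
  \<open>F\<^sub>1(w\<^sub>1 t)\<^sup>m F\<^sub>2(w\<^sub>2 t)\<^sup>m (\<xi>\<^bsup>w1 w2 d\<^esup> e\<^bsup>w1 w2 d t\<^esup> - 1) e\<^bsup>w1 w2 (x+y) t\<^esup>\<close>,
  which is symmetric when \<open>w\<^sub>1\<close> and \<open>w\<^sub>2\<close> are exchanged.
\<close>

lemma binomial_convolution:
  fixes f g :: "'a::field_char_0 fps"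
  shows "(\<Sum>k=0..n. of_nat (n choose k) * (fact k * f $ k) * (fact (n - k) * g $ (n - k)))
         = fact n * (f * g) $ n"
  unfolding fps_mult_nth sum_distrib_left
  by (rule sum.cong) (auto simp: binomial_fact)

text \<open>
  Composition with \<open>c t\<close> rescales the \<open>n\<close>-th coefficient by \<open>c\<^sup>n\<close>.  The exponent \<open>n - j - 1\<close> is \<open>-1\<close>
  for \<open>j = n\<close>, hence the integer power and the factor \<open>1/a\<close>.
\<close>
lemma scaled_binomial_convolution:
  fixes f g h :: "'a::field_char_0 fps" and a b :: 'a
  assumes "a \<noteq> 0"
  shows "(\<Sum>j=0..n. of_nat (n choose j) * b ^ j * a powi (int n - int j - 1)
            * (fact (n - j) * f $ (n - j))
            * (\<Sum>k=0..j. of_nat (j choose k) * (fact k * g $ k) * (fact (j - k) * h $ (j - k))))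
         = fact n / a * (((g * h) oo (fps_const b * fps_X)) * (f oo (fps_const a * fps_X))) $ n"
    (is "?L = _")
proof -
  have "?L = (\<Sum>j=0..n. of_nat (n choose j) * (fact j * ((g * h) oo (fps_const b * fps_X)) $ j)
               * (fact (n - j) * (f oo (fps_const a * fps_X)) $ (n - j))) / a"
    unfolding sum_divide_distrib
  proof (rule sum.cong)
    fix j assume "j \<in> {0..n}"
    then have "int n - int j - 1 = int (n - j) - 1" by auto
    then have "a powi (int n - int j - 1) = a powi (int (n - j) - 1)" by (rule arg_cong)
    also have "\<dots> = a powi int (n - j) / a powi 1"
      using assms by (intro power_int_diff) auto
    finally have powi: "a powi (int n - int j - 1) = a ^ (n - j) / a"
      by (simp only: power_int_of_nat power_int_1_right)
    show "of_nat (n choose j) * b ^ j * a powi (int n - int j - 1)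
            * (fact (n - j) * f $ (n - j))
            * (\<Sum>k=0..j. of_nat (j choose k) * (fact k * g $ k) * (fact (j - k) * h $ (j - k)))
          = of_nat (n choose j) * (fact j * ((g * h) oo (fps_const b * fps_X)) $ j)
               * (fact (n - j) * (f oo (fps_const a * fps_X)) $ (n - j)) / a"
      unfolding binomial_convolution powi fps_compose_linear fps_nth_Abs_fps
      by (simp only: times_divide_eq_left times_divide_eq_right mult_ac)
  qed simp
  also have "\<dots> = fact n / a
      * (((g * h) oo (fps_const b * fps_X)) * (f oo (fps_const a * fps_X))) $ n"
    by (simp only: binomial_convolution times_divide_eq_left)
  finally show ?thesis .
qed

text \<open>
  The generating function \<open>\<Sum>l<N. \<chi>(l) \<zeta>\<^sup>l e\<^bsup>lt\<^esup>\<close> of the power sums; the upper bound is exclusive,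
  whereas that of \<^const>\<open>twisted_power_sum\<close> is inclusive.
\<close>
definition twisted_exp_sum :: "nat \<Rightarrow> (nat \<Rightarrow> 'a::field_char_0) \<Rightarrow> 'a \<Rightarrow> 'a fps" where
  "twisted_exp_sum N chi \<zeta> = (\<Sum>l<N. fps_const (chi l * \<zeta> ^ l) * fps_exp (of_nat l))"

lemma twisted_power_sum_egf:
  assumes "N > 0"
  shows "twisted_power_sum k chi \<zeta> (N - 1) = fact k * twisted_exp_sum N chi \<zeta> $ k"
proof -
  have "{0..N - 1} = {..<N}" using assms by auto
  then show ?thesis
    by (simp add: twisted_power_sum_def twisted_exp_sum_def fps_sum_nth sum_distrib_left mult_ac)
qed

lemma bernoulli_numer_eq_twisted_exp_sum:
  assumes "d > 0"
  shows "bernoulli_numer d chi \<zeta> = fps_X * twisted_exp_sum d chi \<zeta>"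
proof -
  have "{0..d - 1} = {..<d}" using assms by auto
  then show ?thesis by (simp add: bernoulli_numer_def twisted_exp_sum_def)
qed

lemma periodic_add_mult:
  assumes "\<And>a. chi (a + d) = chi a"
  shows "chi (a + i * d) = chi (a :: nat)"
proof (induction i)
  case (Suc i)
  then show ?case using assms[of "a + i * d"] by (simp add: algebra_simps)
qed simp

text \<open>
  Cutting the sum into \<open>w\<close> blocks of length \<open>d\<close> yields a geometric series with ratio
  \<open>q = \<zeta>\<^sup>d e\<^bsup>dt\<^esup>\<close>, and \<^const>\<open>bernoulli_denom\<close> is \<open>q - 1\<close> at \<open>d\<close> and \<open>q\<^sup>w - 1\<close> at \<open>w d\<close>.
\<close>
lemma twisted_exp_sum_periodic:
  fixes chi :: "nat \<Rightarrow> 'a::field_char_0"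
  assumes "\<And>a. chi (a + d) = chi a"
  shows "twisted_exp_sum (w * d) chi \<zeta> * bernoulli_denom d \<zeta>
         = twisted_exp_sum d chi \<zeta> * bernoulli_denom (w * d) \<zeta>"
proof -
  define q where "q = fps_const (\<zeta> ^ d) * fps_exp (of_nat d)"
  have q_power: "q ^ i = fps_const (\<zeta> ^ (i * d)) * fps_exp (of_nat (i * d))" for i
    by (simp add: q_def power_mult_distrib fps_exp_power_mult fps_const_power power_mult [symmetric]
        mult.commute)
  have block: "(\<Sum>l=i*d..<i*d+d. fps_const (chi l * \<zeta> ^ l) * fps_exp (of_nat l))
      = q ^ i * twisted_exp_sum d chi \<zeta>" for i
  proof -
    have "(\<Sum>l=i*d..<i*d+d. fps_const (chi l * \<zeta> ^ l) * fps_exp (of_nat l))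
        = (\<Sum>a<d. fps_const (chi (a + i * d) * \<zeta> ^ (a + i * d)) * fps_exp (of_nat (a + i * d)))"
      using sum.shift_bounds_nat_ivl
        [of "\<lambda>l. fps_const (chi l * \<zeta> ^ l) * fps_exp (of_nat l)" 0 "i * d" d]
      by (simp only: add.commute[of d] add_0 atLeast0LessThan)
    also have "\<dots> = q ^ i * twisted_exp_sum d chi \<zeta>"
      unfolding twisted_exp_sum_def sum_distrib_left q_power
        periodic_add_mult[where chi = chi, OF assms] power_add of_nat_add fps_exp_add_mult
        fps_const_mult [symmetric]
      by (simp only: mult_ac)
    finally show ?thesis .
  qed
  have "twisted_exp_sum (w * d) chi \<zeta> = (\<Sum>i<w. q ^ i) * twisted_exp_sum d chi \<zeta>"
    unfolding twisted_exp_sum_def[of "w * d"] sum.nat_group[symmetric] block sum_distrib_right ..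
  moreover have "bernoulli_denom (w * d) \<zeta> = (q - 1) * (\<Sum>i<w. q ^ i)"
    unfolding bernoulli_denom_def power_diff_1_eq[symmetric] q_power[of w] ..
  moreover have "bernoulli_denom d \<zeta> = q - 1"
    by (simp add: bernoulli_denom_def q_def)
  ultimately show ?thesis by (simp add: mult_ac)
qed

text \<open>
  The quotient on the right is exact even when \<open>\<zeta>\<^sup>d = 1\<close>, where the denominator has a simple zero at
  \<open>t = 0\<close>, because the factor \<open>t\<close> of the numerator cancels it.
\<close>
lemma fps_X_times_twisted_exp_sum:
  fixes chi :: "nat \<Rightarrow> 'a::field_char_0"
  assumes "\<And>a. chi (a + d) = chi a" "d > 0" "\<zeta> \<noteq> 0"
  shows "fps_X * twisted_exp_sum (w * d) chi \<zeta>
         = bernoulli_numer d chi \<zeta> / bernoulli_denom d \<zeta> * bernoulli_denom (w * d) \<zeta>"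
proof -
  let ?F = "bernoulli_numer d chi \<zeta> / bernoulli_denom d \<zeta>"
  have F: "?F * bernoulli_denom d \<zeta> = fps_X * twisted_exp_sum d chi \<zeta>"
    using bernoulli_denom_dvd_numer[OF assms(2,3)] bernoulli_numer_eq_twisted_exp_sum[OF assms(2)]
    by (metis dvd_div_mult_self)
  have "(fps_X * twisted_exp_sum (w * d) chi \<zeta>) * bernoulli_denom d \<zeta>
      = fps_X * twisted_exp_sum d chi \<zeta> * bernoulli_denom (w * d) \<zeta>"
    by (simp add: twisted_exp_sum_periodic[where chi = chi, OF assms(1)] mult.assoc)
  also have "\<dots> = (?F * bernoulli_denom (w * d) \<zeta>) * bernoulli_denom d \<zeta>"
    by (simp only: F[symmetric] mult_ac)
  finally show ?thesis
    using bernoulli_denom_nonzero(1)[OF assms(2,3)] by simp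
qed

lemma bernoulli_denom_scale:
  "bernoulli_denom (a * d) (\<xi> ^ b) oo (fps_const (of_nat b) * fps_X)
   = fps_const (\<xi> ^ (a * b * d)) * fps_exp (of_nat (a * b * d)) - 1"
proof -
  have "bernoulli_denom (a * d) (\<xi> ^ b) oo (fps_const (of_nat b) * fps_X)
      = fps_const ((\<xi> ^ b) ^ (a * d)) * fps_exp (of_nat b * of_nat (a * d)) - 1"
    unfolding bernoulli_denom_def fps_compose_sub_distrib
    by (subst fps_compose_mult_distrib) (simp_all only: fps_exp_compose_linear fps_const_compose
        fps_compose_1 fps_mult_nth_0 fps_X_nth if_False zero_neq_one mult_zero_right)
  then show ?thesis
    by (simp add: power_mult [symmetric] mult.left_commute mult.assoc mult.commute)
qed

text \<open>
  The symmetric normal form.  With \<open>a = w\<^sub>1\<close> and \<open>b = w\<^sub>2\<close>, the generating function of the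
  left-hand side of the final identity is \<open>1/a\<close> times the product that follows the factor \<open>b t\<close>
  below.  The value found for \<open>b t\<close> times this product is invariant under exchanging \<open>a\<close> and \<open>b\<close>.
\<close>
lemma bernoulli_power_sum_egf_symmetric:
  fixes chi :: "nat \<Rightarrow> 'a::field_char_0" and \<xi> x y :: 'a and a b d m :: nat
  defines "F \<equiv> \<lambda>w. (bernoulli_numer d chi (\<xi> ^ w) / bernoulli_denom d (\<xi> ^ w))"
  defines "G \<equiv> \<lambda>w. F w oo (fps_const (of_nat w) * fps_X)"
  assumes per: "\<And>a. chi (a + d) = chi a" and pos: "d > 0" "a > 0" "b > 0" "m > 0" and "\<xi> \<noteq> 0"
  shows "fps_const (of_nat b) * fps_X *
           (((twisted_exp_sum (a * d) chi (\<xi> ^ b) * (F b ^ (m - 1) * fps_exp (of_nat a * y)))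
               oo (fps_const (of_nat b) * fps_X))
            * ((F a ^ m * fps_exp (of_nat b * x)) oo (fps_const (of_nat a) * fps_X)))
         = G a ^ m * G b ^ m * (fps_const (\<xi> ^ (a * b * d)) * fps_exp (of_nat (a * b * d)) - 1)
             * fps_exp (of_nat a * of_nat b * (x + y))"
proof -
  let ?T = "twisted_exp_sum (a * d) chi (\<xi> ^ b) oo (fps_const (of_nat b) * fps_X)"
  let ?E = "fps_const (\<xi> ^ (a * b * d)) * fps_exp (of_nat (a * b * d)) - 1"
  have "(fps_X * twisted_exp_sum (a * d) chi (\<xi> ^ b)) oo (fps_const (of_nat b) * fps_X)
        = (F b * bernoulli_denom (a * d) (\<xi> ^ b)) oo (fps_const (of_nat b) * fps_X)"
    unfolding F_def using fps_X_times_twisted_exp_sum[where chi = chi, OF per] pos \<open>\<xi> \<noteq> 0\<close> by simp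
  then have T: "fps_const (of_nat b) * fps_X * ?T = G b * ?E"
    by (simp add: fps_compose_mult_distrib bernoulli_denom_scale G_def)
  have m: "G b ^ m = G b * G b ^ (m - 1)"
    using pos by (simp add: power_eq_if)
  have exps: "fps_exp (of_nat a * of_nat b * (x + y))
      = fps_exp (of_nat a * of_nat b * x) * fps_exp (of_nat a * of_nat b * y)"
    by (simp add: fps_exp_add_mult distrib_left)
  have "fps_const (of_nat b) * fps_X *
           (((twisted_exp_sum (a * d) chi (\<xi> ^ b) * (F b ^ (m - 1) * fps_exp (of_nat a * y)))
               oo (fps_const (of_nat b) * fps_X))
            * ((F a ^ m * fps_exp (of_nat b * x)) oo (fps_const (of_nat a) * fps_X)))
      = fps_const (of_nat b) * fps_X * ?T * G b ^ (m - 1) * G a ^ m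
          * fps_exp (of_nat a * of_nat b * x) * fps_exp (of_nat a * of_nat b * y)"
    using fps_compose_power[of "fps_const (of_nat a) * fps_X :: 'a fps"]
      fps_compose_power[of "fps_const (of_nat b) * fps_X :: 'a fps"]
    by (simp add: fps_compose_mult_distrib G_def) (simp add: mult_ac)
  then show ?thesis
    unfolding T m exps by (simp only: mult_ac)
qed

theorem theorem1:
  fixes p d w1 w2 n m :: nat
    and v :: "'a::field_char_0 \<Rightarrow> real"
    and chi :: "nat \<Rightarrow> 'a"
    and \<xi> x y :: 'a
  assumes "prime p"
    and "p_adic_complex_field p v"
    and "d \<ge> 1" "w1 \<ge> 1" "w2 \<ge> 1" "m \<ge> 1"
    and "dirichlet_character d chi" "conductor d chi = d"
    and "\<xi> \<in> p_power_roots_of_unity p"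
  shows
    "(\<Sum>j=0..n. of_nat (n choose j) * of_nat w2 ^ j * of_nat w1 powi (int n - int j - 1)
        * gen_twisted_bernoulli d m (n - j) chi (\<xi> ^ w1) (of_nat w2 * x)
        * (\<Sum>k=0..j. of_nat (j choose k)
             * twisted_power_sum k chi (\<xi> ^ w2) (w1 * d - 1)
             * gen_twisted_bernoulli d (m - 1) (j - k) chi (\<xi> ^ w2) (of_nat w1 * y)))
   = (\<Sum>j=0..n. of_nat (n choose j) * of_nat w1 ^ j * of_nat w2 powi (int n - int j - 1)
        * gen_twisted_bernoulli d m (n - j) chi (\<xi> ^ w2) (of_nat w1 * x)
        * (\<Sum>k=0..j. of_nat (j choose k)
             * twisted_power_sum k chi (\<xi> ^ w1) (w2 * d - 1)
             * gen_twisted_bernoulli d (m - 1) (j - k) chi (\<xi> ^ w1) (of_nat w2 * y)))"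
proof -
  obtain r where "\<xi> ^ (p ^ r) = 1"
    using assms(9) by (auto simp: p_power_roots_of_unity_def)
  moreover have "p ^ r > 0" using \<open>prime p\<close> by (simp add: prime_gt_0_nat)
  ultimately have "\<xi> \<noteq> 0" by (auto simp: zero_power)
  have per: "chi (a + d) = chi a" for a
    using assms(7) by (simp add: dirichlet_character_def)
  define F where "F = (\<lambda>w. bernoulli_numer d chi (\<xi> ^ w) / bernoulli_denom d (\<xi> ^ w))"
  define H where "H = (\<lambda>a b :: nat.
      ((twisted_exp_sum (a * d) chi (\<xi> ^ b) * (F b ^ (m - 1) * fps_exp (of_nat a * y)))
        oo (fps_const (of_nat b) * fps_X))
      * ((F a ^ m * fps_exp (of_nat b * x)) oo (fps_const (of_nat a) * fps_X)))"
  have side: "(\<Sum>j=0..n. of_nat (n choose j) * of_nat b ^ j * of_nat a powi (int n - int j - 1)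
        * gen_twisted_bernoulli d m (n - j) chi (\<xi> ^ a) (of_nat b * x)
        * (\<Sum>k=0..j. of_nat (j choose k)
             * twisted_power_sum k chi (\<xi> ^ b) (a * d - 1)
             * gen_twisted_bernoulli d (m - 1) (j - k) chi (\<xi> ^ b) (of_nat a * y)))
      = fact n / of_nat a * H a b $ n" if "a > 0" for a b
    unfolding gen_twisted_bernoulli_def H_def F_def
    using that \<open>d \<ge> 1\<close>
    by (subst scaled_binomial_convolution [symmetric]) (simp_all only: twisted_power_sum_egf
        nat_0_less_mult_iff of_nat_eq_0_iff neq0_conv less_le_trans[OF zero_less_one])
  have normal_form: "fps_const (of_nat b) * fps_X * H a b
      = (F a oo (fps_const (of_nat a) * fps_X)) ^ m * (F b oo (fps_const (of_nat b) * fps_X)) ^ m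
        * (fps_const (\<xi> ^ (a * b * d)) * fps_exp (of_nat (a * b * d)) - 1)
        * fps_exp (of_nat a * of_nat b * (x + y))" if "a > 0" "b > 0" for a b
    unfolding H_def F_def
    using that assms(3,6) \<open>\<xi> \<noteq> 0\<close>
    by (intro bernoulli_power_sum_egf_symmetric[where chi = chi, OF per]) auto
  have "fps_const (of_nat w2) * fps_X * H w1 w2 = fps_const (of_nat w1) * fps_X * H w2 w1"
    using normal_form[of w1 w2] normal_form[of w2 w1] assms(4,5)
    by (simp only: mult_ac add_ac less_le_trans[OF zero_less_one])
  then have "fps_X * (fps_const (of_nat w2) * H w1 w2) = fps_X * (fps_const (of_nat w1) * H w2 w1)"
    by (simp only: mult_ac)
  then have "fps_const (of_nat w2) * H w1 w2 = fps_const (of_nat w1) * H w2 w1"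
    by simp
  then have "of_nat w2 * H w1 w2 $ n = of_nat w1 * H w2 w1 $ n"
    by (metis fps_mult_left_const_nth)
  then have "fact n / of_nat w1 * H w1 w2 $ n = fact n / of_nat w2 * H w2 w1 $ n"
    using assms(4,5) by (simp add: field_simps)
  then show ?thesis
    using side[of w1 w2] side[of w2 w1] assms(4,5) by simp
qed

end
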